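(* Let $\delta\ge 2$ be an integer. For each $k\in\mathbb{N}$, let $\ell_k\ge1$ be an integer and let $\gamma_{k,0},\ldots,\gamma_{k,\ell_k-1}\ge 2$ be integers with $\prod_{j=0}^{\ell_k-1}\gamma_{k,j}=\delta$. Let $r\in[0,1)$ with greedy $\delta$-expansion $d_\delta(r)=c_0c_1c_2\cdots$ (so each $c_k\in\{0,\ldots,\delta-1\}$), and for each $k$ write uniquely \[c_k=\sum_{j=0}^{\ell_k-1}a_{k,j}\,\gamma_{k,j+1}\cdots\gamma_{k,\ell_k-1}\] with integers $0\le a_{k,j}<\gamma_{k,j}$. Consider the Cantor base $\mathbf{B}=\beta_0\beta_1\beta_2\cdots$ obtained as the concatenation $\prod_{k=0}^{+\infty}(\gamma_{k,0}\gamma_{k,1}\cdots\gamma_{k,\ell_k-1})$. Then the greedy $\mathbf{B}$-expansion of $r$ is the concatenation \[ d_{\mathbf{B}}(r)=\prod_{k=0}^{+\infty}(a_{k,0}a_{k,1}\cdots a_{k,\ell_k-1}).\]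
   Context: A Cantor real base is a sequence $\mathbf{B}=(\beta_n)_{n\in\mathbb{N}}$ of reals $>1$ with $\prod_n\beta_n=+\infty$. For $r\in[0,1]$, the greedy $\mathbf{B}$-expansion $d_{\mathbf{B}}(r)=(a_n)_{n\in\mathbb{N}}$ is defined by: having chosen $a_0,\ldots,a_{N-1}$, the digit $a_N$ is the largest integer such that $\sum_{n=0}^N a_n/(\beta_0\cdots\beta_n)\le r$. For a constant base $\delta$ this is the usual greedy $\delta$-expansion $d_\delta(r)$. Products $\prod$ of words denote concatenation. *)

theory Defs
  imports Complex_Main "HOL-Library.Stream" "HOL-Library.FuncSet"
begin

definition cantor_real_base :: "(nat \<Rightarrow> real) \<Rightarrow> bool" where
  "cantor_real_base B \<longleftrightarrow>
     (\<forall>n. B n > 1) \<and> filterlim (\<lambda>N. \<Prod>n<N. B n) at_top sequentially"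

context
  notes sum.cong [fundef_cong]
begin

fun greedy_expansion :: "(nat \<Rightarrow> real) \<Rightarrow> real \<Rightarrow> nat \<Rightarrow> int" where
  "greedy_expansion B r N =
     (GREATEST a :: int.
        (\<Sum>n<N. real_of_int (greedy_expansion B r n) / (\<Prod>i\<le>n. B i))
          + real_of_int a / (\<Prod>i\<le>N. B i) \<le> r)"

end

declare greedy_expansion.simps [simp del]

text \<open>The concatenation \<open>w 0 @ w 1 @ w 2 @ \<dots>\<close> as a sequence. It has this meaning only
  when all the words \<open>w k\<close> are nonempty, because of the behaviour of \<^const>\<open>flat\<close>
  on empty lists.\<close>

definition concat_seq :: "(nat \<Rightarrow> 'a list) \<Rightarrow> nat \<Rightarrow> 'a" where
  "concat_seq w = snth (flat (smap w nats))"

end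

theory Submission
  imports Defs
begin

text \<open>In an integer Cantor base \<open>b\<close> with partial products \<open>P\<^sub>N = b\<^sub>0 \<cdots> b\<^bsub>N-1\<^esub>\<close>, the partial
  sums of the greedy expansion of \<open>r \<in> [0,1)\<close> are \<open>\<lfloor>r P\<^sub>N\<rfloor> / P\<^sub>N\<close>, so the \<open>N\<close>-th digit is
  \<open>\<lfloor>r P\<^bsub>N+1\<^esub>\<rfloor> mod b\<^sub>N\<close>. At position \<open>j\<close> of block \<open>k\<close>, with \<open>Q\<close> the product of the
  remaining bases of the block, \<open>P\<^bsub>N+1\<^esub> = \<delta>\<^bsup>k+1\<^esup> / Q\<close>, hence the digit is
  \<open>(\<lfloor>r \<delta>\<^bsup>k+1\<^esup>\<rfloor> div Q) mod \<gamma>\<^bsub>k,j\<^esub>\<close>. Since \<open>c\<^sub>k = \<lfloor>r \<delta>\<^bsup>k+1\<^esup>\<rfloor> mod \<delta>\<close> and \<open>\<gamma>\<^bsub>k,j\<^esub> Q\<close>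
  divides \<open>\<delta>\<close>, this equals \<open>(c\<^sub>k div Q) mod \<gamma>\<^bsub>k,j\<^esub>\<close>, the \<open>j\<close>-th mixed radix digit of \<open>c\<^sub>k\<close>.\<close>

section \<open>Concatenation of words\<close>

text \<open>Induction on \<open>k\<close> peels off the first word of \<open>s\<close>, which shifts
  the index by its length. The tail is another stream, so \<open>s\<close> is generalised.\<close>

lemma flat_snth_block:
  assumes "\<And>xs. xs \<in> sset s \<Longrightarrow> xs \<noteq> []" and "j < length (s !! k)"
  shows "flat s !! ((\<Sum>i<k. length (s !! i)) + j) = s !! k ! j"
  using assms
proof (induction k arbitrary: s)
  case 0
  then show ?case by (subst flat_snth) auto
next
  case (Suc k)
  have ne: "xs \<noteq> []" if "xs \<in> sset (stl s)" for xs
    by (rule Suc.prems(1)) (rule stl_sset[OF that])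
  have split: "(\<Sum>i<Suc k. length (s !! i)) = length (shd s) + (\<Sum>i<k. length (stl s !! i))"
    by (simp add: sum.lessThan_Suc_shift del: sum.lessThan_Suc)
  have "flat s !! ((\<Sum>i<Suc k. length (s !! i)) + j)
      = flat (stl s) !! ((\<Sum>i<k. length (stl s !! i)) + j)"
    unfolding split using Suc.prems(1) by (subst flat_snth) auto
  then show ?case using Suc.IH[of "stl s"] ne Suc.prems(2) by simp
qed

lemma concat_seq_block:
  assumes "\<And>k. w k \<noteq> []" and "j < length (w k)"
  shows "concat_seq w ((\<Sum>i<k. length (w i)) + j) = w k ! j"
proof -
  have "xs \<noteq> []" if "xs \<in> sset (smap w nats)" for xs
    using that assms(1) by (auto simp: stream.set_map)
  from flat_snth_block[of "smap w nats" j k, OF this] show ?thesis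
    using assms(2) by (simp add: concat_seq_def)
qed

lemma concat_seq_map_block:
  assumes "\<And>k. l k \<ge> 1" and "j < l k"
  shows "concat_seq (\<lambda>k. map (f k) [0..<l k]) ((\<Sum>i<k. l i) + j) = f k j"
  using concat_seq_block[of "\<lambda>k. map (f k) [0..<l k]" j k] assms
  by (simp add: Suc_le_eq)

text \<open>Reduces claims about a concatenated sequence to claims about one block: the successor of
  a position stays in its block or opens the next, nonempty one.\<close>

lemma block_position:
  fixes l :: "nat \<Rightarrow> nat"
  assumes "\<And>k. l k \<ge> 1"
  obtains k j where "n = (\<Sum>i<k. l i) + j" "j < l k"
proof -
  have "\<exists>k j. n = (\<Sum>i<k. l i) + j \<and> j < l k"
  proof (induction n)
    case 0
    show ?case using assms[of 0] by (intro exI[of _ 0]) auto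
  next
    case (Suc n)
    then obtain k j where kj: "n = (\<Sum>i<k. l i) + j" "j < l k" by blast
    show ?case
    proof (cases "Suc j < l k")
      case True
      then show ?thesis using kj by (intro exI[of _ k] exI[of _ "Suc j"]) auto
    next
      case False
      then show ?thesis using kj assms[of "Suc k"]
        by (intro exI[of _ "Suc k"] exI[of _ 0]) auto
    qed
  qed
  then show thesis using that by blast
qed

text \<open>The case \<open>m = l k\<close> of the inner fact closes a whole block, which drives the
  induction over blocks.\<close>

lemma prod_concat_seq:
  fixes f :: "nat \<Rightarrow> nat \<Rightarrow> 'a::comm_monoid_mult"
  assumes "\<And>k. l k \<ge> 1" and "m \<le> l k"
  shows "(\<Prod>n<(\<Sum>i<k. l i) + m. concat_seq (\<lambda>k. map (f k) [0..<l k]) n)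
    = (\<Prod>i<k. \<Prod>j<l i. f i j) * (\<Prod>j<m. f k j)"
proof -
  let ?b = "concat_seq (\<lambda>k. map (f k) [0..<l k])"
  have block: "prod ?b {..<(\<Sum>i<k. l i) + m} = prod ?b {..<(\<Sum>i<k. l i)} * (\<Prod>j<m. f k j)"
    if "m \<le> l k" for k m
    using that
    by (induction m) (auto simp: concat_seq_map_block[OF assms(1)] mult_ac)
  have "prod ?b {..<(\<Sum>i<k. l i)} = (\<Prod>i<k. \<Prod>j<l i. f i j)"
    by (induction k) (simp_all add: block)
  then show ?thesis using block[OF assms(2)] by simp
qed

section \<open>Greedy expansions in integer bases\<close>

lemma Greatest_int_floor:
  fixes S P r :: real
  assumes "P > 0"
  shows "(GREATEST a :: int. S + real_of_int a / P \<le> r) = \<lfloor>(r - S) * P\<rfloor>"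
proof -
  have "S + real_of_int a / P \<le> r \<longleftrightarrow> a \<le> \<lfloor>(r - S) * P\<rfloor>" for a
    using assms by (simp add: le_floor_iff field_simps)
  then show ?thesis by (intro Greatest_equality) auto
qed

text \<open>Links floors at different scales: from one partial product to the previous one, and from
  \<delta>^(k+1) back to a position inside block \<open>k\<close>.\<close>

lemma floor_mult_div_int:
  fixes b :: int
  assumes "b > 0"
  shows "\<lfloor>x * real_of_int b\<rfloor> div b = \<lfloor>x\<rfloor>"
  using floor_divide_real_eq_div[of b "x * real_of_int b"] assms by simp

lemma greedy_expansion_int_base:
  fixes b :: "nat \<Rightarrow> int"
  assumes b: "\<And>n. b n > 0" and r: "0 \<le> r" "r < 1"
  shows "greedy_expansion (\<lambda>n. real_of_int (b n)) r N
    = \<lfloor>r * real_of_int (\<Prod>i<Suc N. b i)\<rfloor> mod b N"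
proof -
  define P where "P N = (\<Prod>i<N. b i)" for N
  define g where "g = greedy_expansion (\<lambda>n. real_of_int (b n)) r"
  have P: "P N > 0" for N unfolding P_def using b by (simp add: prod_pos)
  have PSuc: "P (Suc N) = P N * b N" for N by (simp add: P_def)
  have Pr: "(\<Prod>i\<le>N. real_of_int (b i)) = real_of_int (P (Suc N))" for N
    by (simp add: P_def lessThan_Suc_atMost del: prod.lessThan_Suc)
  \<comment> \<open>The formula for the partial sum is a premise here because its own induction
    needs the digit formula at \<open>N\<close>.\<close>
  have digit: "g N = \<lfloor>r * real_of_int (P (Suc N))\<rfloor> mod b N"
    if S: "(\<Sum>n<N. real_of_int (g n) / real_of_int (P (Suc n))) = real_of_int \<lfloor>r * real_of_int (P N)\<rfloor> / real_of_int (P N)"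
    for N
  proof -
    let ?F = "\<lfloor>r * real_of_int (P N)\<rfloor>"
    have "g N = \<lfloor>(r - real_of_int ?F / real_of_int (P N)) * real_of_int (P (Suc N))\<rfloor>"
      unfolding g_def greedy_expansion.simps[of _ _ N] unfolding Pr g_def[symmetric] S
      using P by (intro Greatest_int_floor) simp
    also have "(r - real_of_int ?F / real_of_int (P N)) * real_of_int (P (Suc N))
        = r * real_of_int (P (Suc N)) - real_of_int (?F * b N)"
      using P[of N] by (simp add: PSuc field_simps)
    also have "\<lfloor>\<dots>\<rfloor> = \<lfloor>r * real_of_int (P (Suc N))\<rfloor> - ?F * b N"
      by (rule floor_diff_of_int)
    also have "?F = \<lfloor>r * real_of_int (P (Suc N))\<rfloor> div b N"
      using floor_mult_div_int[OF b, of "r * real_of_int (P N)" N]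
      by (simp add: PSuc mult_ac)
    finally show ?thesis by (simp add: minus_div_mult_eq_mod)
  qed
  have "(\<Sum>n<N. real_of_int (g n) / real_of_int (P (Suc n))) = real_of_int \<lfloor>r * real_of_int (P N)\<rfloor> / real_of_int (P N)"
    for N
  proof (induction N)
    case 0
    \<comment> \<open>Here \<open>r < 1\<close> enters: the empty partial sum has to equal the floor
      of \<open>r\<close>.\<close>
    have "\<lfloor>r\<rfloor> = 0" using r by (simp add: floor_eq_iff)
    then show ?case by (simp add: P_def)
  next
    case (Suc N)
    let ?X = "\<lfloor>r * real_of_int (P (Suc N))\<rfloor>"
    have "?X div b N = \<lfloor>r * real_of_int (P N)\<rfloor>"
      using floor_mult_div_int[OF b, of "r * real_of_int (P N)" N]
      by (simp add: PSuc mult_ac)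
    then have "?X = \<lfloor>r * real_of_int (P N)\<rfloor> * b N + g N"
      using digit[OF Suc] by (metis div_mult_mod_eq)
    then have X: "real_of_int ?X = real_of_int \<lfloor>r * real_of_int (P N)\<rfloor> * real_of_int (b N) + real_of_int (g N)"
      by (metis of_int_add of_int_mult)
    show ?case
      unfolding sum.lessThan_Suc Suc X
      using P[of N] b[of N] by (simp add: PSuc field_simps)
  qed
  from digit[OF this, of N] show ?thesis by (simp only: g_def P_def)
qed

section \<open>Mixed radix representations\<close>

lemma prod_Suc_upt_Suc:
  fixes g :: "nat \<Rightarrow> 'a::comm_monoid_mult"
  shows "j < l \<Longrightarrow> (\<Prod>i\<in>{j+1..<Suc l}. g i) = g l * (\<Prod>i\<in>{j+1..<l}. g i)"
  by (simp add: mult.commute)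

text \<open>Horner's rule, adding a least significant digit; it drives the inductions on
  \<open>l\<close> below.\<close>

lemma mixed_radix_sum_Suc:
  fixes w g :: "nat \<Rightarrow> 'a::comm_semiring_1"
  shows "(\<Sum>j<Suc l. w j * (\<Prod>i\<in>{j+1..<Suc l}. g i))
    = (\<Sum>j<l. w j * (\<Prod>i\<in>{j+1..<l}. g i)) * g l + w l"
proof -
  have "(\<Sum>j<l. w j * (\<Prod>i\<in>{j+1..<Suc l}. g i)) = (\<Sum>j<l. w j * (\<Prod>i\<in>{j+1..<l}. g i)) * g l"
    unfolding sum_distrib_right
    by (intro sum.cong refl) (simp add: mult_ac)
  then show ?thesis by simp
qed

text \<open>For \<open>j < l\<close>, dividing by the last base \<open>g l\<close> first discards
  the digit \<open>w l\<close> and leaves the value of the shorter word. For \<open>j = l\<close>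
  the divisor is an empty product.\<close>

lemma mixed_radix_digit:
  fixes w g :: "nat \<Rightarrow> int"
  assumes "\<And>j. j < l \<Longrightarrow> 0 \<le> w j \<and> w j < g j" and "j < l"
  shows "(\<Sum>j<l. w j * (\<Prod>i\<in>{j+1..<l}. g i)) div (\<Prod>i\<in>{j+1..<l}. g i) mod g j = w j"
  using assms
proof (induction l)
  case (Suc l)
  let ?V = "\<Sum>j<l. w j * (\<Prod>i\<in>{j+1..<l}. g i)"
  have wl: "0 \<le> w l" "w l < g l" using Suc.prems(1)[of l] by auto
  show ?case
  proof (cases "j = l")
    case True
    then show ?thesis unfolding mixed_radix_sum_Suc using wl by simp
  next
    case False
    then have j: "j < l" using Suc.prems by simp
    have pos: "0 < g i" if "i < Suc l" for i using Suc.prems(1)[OF that] by linarith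
    have "0 \<le> (\<Prod>i\<in>{j+1..<l}. g i)" by (intro prod_nonneg) (auto intro!: less_imp_le[OF pos])
    then have "(?V * g l + w l) div (g l * (\<Prod>i\<in>{j+1..<l}. g i))
        = (?V * g l + w l) div g l div (\<Prod>i\<in>{j+1..<l}. g i)"
      by (rule zdiv_zmult2_eq)
    also have "(?V * g l + w l) div g l = ?V" using wl by simp
    finally show ?thesis
      unfolding mixed_radix_sum_Suc prod_Suc_upt_Suc[OF j]
      using Suc.IH[OF Suc.prems(1)[OF less_SucI] j] by (simp only:)
  qed
qed simp

lemma mixed_radix_exists:
  fixes g :: "nat \<Rightarrow> int"
  assumes "\<And>j. j < l \<Longrightarrow> g j > 0" and "0 \<le> x" "x < (\<Prod>j<l. g j)"
  shows "\<exists>w. (\<forall>j<l. 0 \<le> w j \<and> w j < g j) \<and> x = (\<Sum>j<l. w j * (\<Prod>i\<in>{j+1..<l}. g i))"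
  using assms
proof (induction l arbitrary: x)
  case (Suc l)
  have gl: "g l > 0" using Suc.prems by simp
  have "0 \<le> x div g l" using gl Suc.prems(2) by (simp add: pos_imp_zdiv_nonneg_iff)
  moreover have "x div g l < (\<Prod>j<l. g j)"
  proof (rule ccontr)
    assume "\<not> x div g l < (\<Prod>j<l. g j)"
    then have "(\<Prod>j<l. g j) * g l \<le> x div g l * g l" using gl by (intro mult_right_mono) auto
    also have "\<dots> \<le> x" using gl by (simp add: minus_mod_eq_div_mult[symmetric])
    finally show False using Suc.prems(3) by simp
  qed
  ultimately obtain w where w: "\<forall>j<l. 0 \<le> w j \<and> w j < g j"
    "x div g l = (\<Sum>j<l. w j * (\<Prod>i\<in>{j+1..<l}. g i))"
    using Suc.IH[of "x div g l"] Suc.prems(1) by auto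
  \<comment> \<open>The remainder modulo the last base is the least significant digit; the quotient
    supplies the others.\<close>
  let ?w = "w(l := x mod g l)"
  have "(\<Sum>j<Suc l. ?w j * (\<Prod>i\<in>{j+1..<Suc l}. g i)) = x div g l * g l + x mod g l"
    unfolding mixed_radix_sum_Suc w(2) by simp
  then show ?case using w(1) gl by (intro exI[of _ ?w]) (auto simp: less_Suc_eq)
qed simp

lemma mixed_radix_ex1:
  fixes g :: "nat \<Rightarrow> int"
  assumes g: "\<And>j. j < l \<Longrightarrow> g j > 0" and x: "0 \<le> x" "x < (\<Prod>j<l. g j)"
  shows "\<exists>!w. w \<in> (\<Pi>\<^sub>E j\<in>{..<l}. {0..<g j}) \<and> x = (\<Sum>j<l. w j * (\<Prod>i\<in>{j+1..<l}. g i))"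
proof (rule ex_ex1I)
  obtain w where w: "\<forall>j<l. 0 \<le> w j \<and> w j < g j" "x = (\<Sum>j<l. w j * (\<Prod>i\<in>{j+1..<l}. g i))"
    using mixed_radix_exists[OF g x] by blast
  then show "\<exists>w. w \<in> (\<Pi>\<^sub>E j\<in>{..<l}. {0..<g j}) \<and> x = (\<Sum>j<l. w j * (\<Prod>i\<in>{j+1..<l}. g i))"
    \<comment> \<open>Restriction fixes the values outside \<open>{..<l}\<close>, so that uniqueness
      can be equality of functions.\<close>
    by (intro exI[of _ "restrict w {..<l}"]) (auto intro!: sum.cong)
next
  fix v w
  assume v: "v \<in> (\<Pi>\<^sub>E j\<in>{..<l}. {0..<g j}) \<and> x = (\<Sum>j<l. v j * (\<Prod>i\<in>{j+1..<l}. g i))"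
    and w: "w \<in> (\<Pi>\<^sub>E j\<in>{..<l}. {0..<g j}) \<and> x = (\<Sum>j<l. w j * (\<Prod>i\<in>{j+1..<l}. g i))"
  have bounds: "0 \<le> u j \<and> u j < g j" if "u \<in> (\<Pi>\<^sub>E j\<in>{..<l}. {0..<g j})" "j < l" for u j
    using PiE_mem[OF that(1), of j] that(2) by simp
  have "v j = w j" if "j < l" for j
    using mixed_radix_digit[of l v g j] mixed_radix_digit[of l w g j] bounds v w that by metis
  then show "v = w" using v w by (intro PiE_ext[of v _ _ w]) auto
qed

text \<open>\<open>x\<close> and \<open>x mod m\<close> differ by a multiple of
  \<open>d * q\<close>, so their quotients by \<open>q\<close> differ by a multiple of
  \<open>d\<close>.\<close>

lemma mod_div_mod_cancel:
  fixes x m q d :: int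
  assumes "q \<noteq> 0" and "d * q dvd m"
  shows "(x mod m) div q mod d = x div q mod d"
proof -
  obtain e where e: "m = d * q * e" using assms(2) by blast
  have "x = q * (d * e * (x div m)) + x mod m"
    using mult_div_mod_eq[of m x] by (simp add: e mult_ac)
  then have "x div q = d * e * (x div m) + x mod m div q"
    using assms(1) by (metis div_mult_self4)
  then show ?thesis by (simp add: mult.assoc)
qed

theorem theorem2p4:
  fixes \<delta> :: int and l :: "nat \<Rightarrow> nat" and \<gamma> :: "nat \<Rightarrow> nat \<Rightarrow> int"
    and r :: real and c :: "nat \<Rightarrow> int" and B :: "nat \<Rightarrow> real"
  assumes "\<delta> \<ge> 2"
    and "\<And>k. l k \<ge> 1"
    and "\<And>k j. j < l k \<Longrightarrow> \<gamma> k j \<ge> 2"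
    and "\<And>k. (\<Prod>j<l k. \<gamma> k j) = \<delta>"
    and "0 \<le> r" and "r < 1"
    and "c = greedy_expansion (\<lambda>_. real_of_int \<delta>) r"
    and "B = concat_seq (\<lambda>k. map (\<lambda>j. real_of_int (\<gamma> k j)) [0..<l k])"
  shows "(\<forall>k. c k \<in> {0..\<delta> - 1})
    \<and> (\<forall>k. \<exists>!w. w \<in> (\<Pi>\<^sub>E j\<in>{..<l k}. {0..<\<gamma> k j})
          \<and> c k = (\<Sum>j<l k. w j * (\<Prod>i\<in>{j+1..<l k}. \<gamma> k i)))
    \<and> cantor_real_base B
    \<and> (\<forall>a :: nat \<Rightarrow> nat \<Rightarrow> int.
          (\<forall>k. \<forall>j<l k. 0 \<le> a k j \<and> a k j < \<gamma> k j) \<and>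
          (\<forall>k. c k = (\<Sum>j<l k. a k j * (\<Prod>i\<in>{j+1..<l k}. \<gamma> k i)))
          \<longrightarrow> greedy_expansion B r = concat_seq (\<lambda>k. map (a k) [0..<l k]))"
proof (intro conjI allI impI)
  note l = assms(2) and \<gamma> = assms(3) and \<delta>_eq = assms(4) and r = assms(5,6)
  define b where "b = concat_seq (\<lambda>k. map (\<gamma> k) [0..<l k])"
  have b_block: "b ((\<Sum>i<k. l i) + j) = \<gamma> k j" if "j < l k" for k j
    unfolding b_def using concat_seq_map_block[of l j k \<gamma>] l that by simp
  have b2: "b n \<ge> 2" for n
  proof -
    obtain k j where "n = (\<Sum>i<k. l i) + j" "j < l k" by (rule block_position[OF l])
    then show ?thesis using b_block \<gamma> by simp
  qed
  have b_pos: "b n > 0" for n using b2[of n] by simp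
  have "B n = real_of_int (b n)" for n
  proof -
    obtain k j where "n = (\<Sum>i<k. l i) + j" "j < l k" by (rule block_position[OF l])
    then show ?thesis
      unfolding assms(8) using b_block concat_seq_map_block[of l j k "\<lambda>k j. real_of_int (\<gamma> k j)"] l
      by simp
  qed
  then have B: "B = (\<lambda>n. real_of_int (b n))" by blast
  have c: "c k = \<lfloor>r * real_of_int (\<delta> ^ Suc k)\<rfloor> mod \<delta>" for k
    unfolding assms(7) using greedy_expansion_int_base[of "\<lambda>_. \<delta>" r k] assms(1) r by simp
  then have c_bounds: "0 \<le> c k" "c k < \<delta>" for k using assms(1) by auto
  then show "c k \<in> {0..\<delta> - 1}" for k using c_bounds[of k] by simp
  show "\<exists>!w. w \<in> (\<Pi>\<^sub>E j\<in>{..<l k}. {0..<\<gamma> k j})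
      \<and> c k = (\<Sum>j<l k. w j * (\<Prod>i\<in>{j+1..<l k}. \<gamma> k i))" for k
    using c_bounds[of k] \<gamma>[of _ k] \<delta>_eq[of k] by (intro mixed_radix_ex1) force+
  show "cantor_real_base B"
    unfolding cantor_real_base_def
  proof (intro conjI allI)
    show "B n > 1" for n using b2[of n] by (simp add: B)
    \<comment> \<open>Every base is at least 2, so the partial products outgrow the powers of
      2.\<close>
    have "2 ^ N \<le> (\<Prod>n<N. B n)" for N
      using prod_mono[of "{..<N}" "\<lambda>_. 2" B] b2 by (simp add: B)
    moreover have "filterlim (\<lambda>N. (2::real) ^ N) at_top sequentially"
      using filterlim_realpow_sequentially_gt1[of "2::real"]
      by (intro filterlim_at_infinity_imp_filterlim_at_top) auto
    ultimately show "filterlim (\<lambda>N. \<Prod>n<N. B n) at_top sequentially"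
      by (auto elim: filterlim_at_top_mono)
  qed
  fix a :: "nat \<Rightarrow> nat \<Rightarrow> int"
  assume a: "(\<forall>k. \<forall>j<l k. 0 \<le> a k j \<and> a k j < \<gamma> k j) \<and>
    (\<forall>k. c k = (\<Sum>j<l k. a k j * (\<Prod>i\<in>{j+1..<l k}. \<gamma> k i)))"
  show "greedy_expansion B r = concat_seq (\<lambda>k. map (a k) [0..<l k])"
  proof
    fix n
    obtain k j where n: "n = (\<Sum>i<k. l i) + j" and j: "j < l k" by (rule block_position[OF l])
    define Q where "Q = (\<Prod>i\<in>{j+1..<l k}. \<gamma> k i)"
    have Q: "Q > 0" unfolding Q_def using \<gamma>[of _ k] by (intro prod_pos) force
    have split: "\<delta> = (\<Prod>i<Suc j. \<gamma> k i) * Q"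
      unfolding Q_def \<delta>_eq[of k, symmetric] using j
      by (simp add: prod.atLeastLessThan_concat lessThan_atLeast0 del: prod.lessThan_Suc prod.op_ivl_Suc)
    \<comment> \<open>The bases up to and including position \<open>n\<close> are \<open>k\<close>
      whole blocks, each with product \<delta>, and the first \<open>j + 1\<close> bases of block
      \<open>k\<close>.\<close>
    have "(\<Prod>i<Suc n. b i) = \<delta> ^ k * (\<Prod>i<Suc j. \<gamma> k i)"
      using prod_concat_seq[of l "Suc j" k \<gamma>] l j unfolding b_def n \<delta>_eq
      by (simp del: prod.lessThan_Suc)
    then have "(\<Prod>i<Suc n. b i) * Q = \<delta> ^ Suc k"
      using split by (simp add: mult_ac del: prod.lessThan_Suc)
    then have "\<lfloor>r * real_of_int (\<Prod>i<Suc n. b i)\<rfloor> = \<lfloor>r * real_of_int (\<delta> ^ Suc k)\<rfloor> div Q"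
      using floor_mult_div_int[OF Q, of "r * real_of_int (\<Prod>i<Suc n. b i)"]
      by (metis mult.assoc of_int_mult)
    then have "greedy_expansion B r n = \<lfloor>r * real_of_int (\<delta> ^ Suc k)\<rfloor> div Q mod \<gamma> k j"
      using greedy_expansion_int_base[of b r n] b_pos r b_block[OF j] by (simp only: B n)
    \<comment> \<open>By \<open>split\<close>, \<open>\<gamma> k j * Q\<close> divides \<delta>, so
      the reduction modulo \<delta> in \<open>c k\<close> does not affect this digit.\<close>
    also have "\<dots> = c k div Q mod \<gamma> k j"
      unfolding c using Q split by (intro mod_div_mod_cancel[symmetric]) auto
    also have "\<dots> = a k j"
      using mixed_radix_digit[of "l k" "a k" "\<gamma> k" j] a j unfolding Q_def by metis
    also have "\<dots> = concat_seq (\<lambda>k. map (a k) [0..<l k]) n"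
      unfolding n using concat_seq_map_block[of l j k a] l j by simp
    finally show "greedy_expansion B r n = concat_seq (\<lambda>k. map (a k) [0..<l k]) n" .
  qed
qed

end
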